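(* Let $m,n\in\mathbb{N}$ and let $(M,\mathbf{G})$ be one of the pairs $(\mathbf{NA}_{m,n},\mathbf{GNA}_{m,n})$, $(\mathbf{N}^+\mathbf{A}_{m,n},\mathbf{GN}^+\mathbf{A}_{m,n})$, $(\mathbf{NRA}_{m,n},\mathbf{GNRA}_{m,n})$. Let $\sharp,\flat:\mathscr{L}_\Box\to\mathscr{L}_p'$ be the translations associated with $M$ (defined in the context). If a sequent $\Gamma\Longrightarrow\Delta$ of formulas of $\mathscr{L}_\Box$ is provable in $\mathbf{G}$, then the sequent $\Gamma^\flat\Longrightarrow\Delta^\sharp$ is provable in $\mathbf{LK}$.
   Context: $\mathbb{N}$ includes $0$. Fix a countably infinite set $\mathrm{PropVar}$ of propositional variables. $\mathscr{L}_\Box$ is the set of formulas built from $\mathrm{PropVar}$ with $\land,\lor,\to,\bot,\Box$; $\top:=\bot\to\bot$, $\neg\varphi:=\varphi\to\bot$; $\Box^0\varphi:=\varphi$, $\Box^{k+1}\varphi:=\Box\Box^k\varphi$. Logics. $\mathbf{N}$ is classical propositional logic (tautologies in the language $\mathscr{L}_\Box$, modus ponens) plus the rule Nec: from $\varphi$ infer $\Box\varphi$. $\mathbf{NA}_{m,n}$ is $\mathbf{N}$ plus the axiom schema $\Box^n\varphi\to\Box^m\varphi$. $\mathbf{N}^+\mathbf{A}_{m,n}$ is $\mathbf{NA}_{m,n}$ plus the rule: from $\neg\Box\varphi$ infer $\neg\Box\Box\varphi$. $\mathbf{NRA}_{m,n}$ is $\mathbf{NA}_{m,n}$ plus the rule: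 from $\neg\varphi$ infer $\neg\Box\varphi$. (Rules apply to theorems.) Extended propositional language. For each $\varphi\in\mathscr{L}_\Box$ let $p_\varphi\notin\mathrm{PropVar}$ be a fresh variable (distinct for distinct $\varphi$); $\mathrm{PropVar}'=\mathrm{PropVar}\cup\{p_\varphi:\varphi\in\mathscr{L}_\Box\}$. $\mathscr{L}_p'$ is the set of formulas built from $\mathrm{PropVar}'$ with $\land,\lor,\to,\bot$. Sequents. A sequent $\Gamma\Longrightarrow\Delta$ is a pair of finite sets of formulas; $\varphi,\Gamma$ means $\{\varphi\}\cup\Gamma$, $\Gamma,\Delta$ means $\Gamma\cup\Delta$, and empty sets are omitted. The calculus $\mathbf{LK}$ (in the claim, over formulas of $\mathscr{L}_p'$). Initial sequents: $\varphi\Longrightarrow\varphi$ and $\bot\Longrightarrow$. Rules (premises / conclusion): ($\land$L) $\Gamma,\varphi_i\Longrightarrow\Delta$ / $\Gamma,\varphi_1\land\varphi_2\Longrightarrow\Delta$ ($i=1,2$); ($\land$R) $\Gamma\Longrightarrow\varphi_1,\Delta$ and $\Gamma\Longrightarrow\varphi_2,\Delta$ / $\Gamma\Longrightarrow\varphi_1\land\varphi_2,\Delta$; ($\lor$L) $\Gamma,\varphi_1\Longrightarrow\Delta$ and $\Gamma,\varphi_2\Longrightarrow\Delta$ / $\Gamma,\varphi_1\lor\varphi_2\Longrightarrow\Delta$; ($\lor$R) $\Gamma\Longrightarrow\varphi_i,\Delta$ / $\Gamma\Longrightarrow\varphi_1\lor\varphi_2,\Delta$ ($i=1,2$); ($\to$L)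 $\Gamma_1\Longrightarrow\varphi,\Delta_1$ and $\Gamma_2,\psi\Longrightarrow\Delta_2$ / $\Gamma_1,\Gamma_2,\varphi\to\psi\Longrightarrow\Delta_1,\Delta_2$; ($\to$R) $\Gamma,\varphi\Longrightarrow\psi,\Delta$ / $\Gamma\Longrightarrow\varphi\to\psi,\Delta$; (wL) $\Gamma\Longrightarrow\Delta$ / $\Gamma,\varphi\Longrightarrow\Delta$; (wR) $\Gamma\Longrightarrow\Delta$ / $\Gamma\Longrightarrow\varphi,\Delta$; (cut) $\Gamma_1\Longrightarrow\Delta_1,\varphi$ and $\varphi,\Gamma_2\Longrightarrow\Delta_2$ / $\Gamma_1,\Gamma_2\Longrightarrow\Delta_1,\Delta_2$. Modal calculi (over $\mathscr{L}_\Box$). $\mathbf{GNA}_{m,n}$ has the initial sequents and all rules of $\mathbf{LK}$ (for formulas of $\mathscr{L}_\Box$), plus: (nec) $\Longrightarrow\varphi$ / $\Longrightarrow\Box\varphi$; (accL, only when $n>m$) $\Box^m\varphi,\Box^n\varphi,\Gamma\Longrightarrow\Delta$ / $\Box^n\varphi,\Gamma\Longrightarrow\Delta$; (accR, only when $m>n$) $\Gamma\Longrightarrow\Delta,\Box^m\varphi,\Box^n\varphi$ / $\Gamma\Longrightarrow\Delta,\Box^m\varphi$. $\mathbf{GN}^+\mathbf{A}_{m,n}$ is $\mathbf{GNA}_{m,n}$ plus (rosbox, only when $m=0$ and $n\ge2$) $\Box\varphi\Longrightarrow$ / $\Box\Box\varphi\Longrightarrow$. $\mathbf{GNRA}_{m,n}$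 is $\mathbf{GNA}_{m,n}$ plus (ros) $\varphi\Longrightarrow$ / $\Box\varphi\Longrightarrow$. Translations associated with $M$. $\varphi^\sharp,\varphi^\flat\in\mathscr{L}_p'$ are defined inductively for $\varphi\in\mathscr{L}_\Box$: - $\bot^\natural=\bot$, $p^\natural=p$, $(\psi_1\circledcirc\psi_2)^\natural=\psi_1^\natural\circledcirc\psi_2^\natural$ for $\natural\in\{\sharp,\flat\}$, $\circledcirc\in\{\land,\lor\}$; - $(\psi_1\to\psi_2)^\sharp=\psi_1^\flat\to\psi_2^\sharp$ and $(\psi_1\to\psi_2)^\flat=\psi_1^\sharp\to\psi_2^\flat$; - for $\Box^k\psi$ with $k\ge1$ and $\psi$ not of the form $\Box\chi$: $(\Box^k\psi)^\sharp=\top$ if $M\vdash\Box^{k-1}\psi$; $(\Box^k\psi)^\sharp=p_{\Box^k\psi}\lor(\Box^{k-m+n}\psi)^\sharp$ if $M\nvdash\Box^{k-1}\psi$ and $k\ge m>n$; $(\Box^k\psi)^\sharp=p_{\Box^k\psi}$ otherwise. $(\Box^k\psi)^\flat=\bot$ if $C(k,\psi)$; $(\Box^k\psi)^\flat=p_{\Box^k\psi}\land(\Box^{k-n+m}\psi)^\flat$ if not $C(k,\psi)$ and $k\ge n>m$; $(\Box^k\psi)^\flat=p_{\Box^k\psi}$ otherwise. Here $C(k,\psi)$ holds exactly when either $M=\mathbf{N}^+\mathbf{A}_{m,n}$ (as the chosen case), $m=0$, $n\ge2$, $k\ge2$ and $\mathbf{N}^+\mathbf{A}_{m,n}\vdash\neg\Box^{k-1}\psi$;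 or $M=\mathbf{NRA}_{m,n}$ (as the chosen case) and $\mathbf{NRA}_{m,n}\vdash\neg\Box^{k-1}\psi$. For a set $\Gamma\subseteq\mathscr{L}_\Box$ and $\natural\in\{\sharp,\flat\}$, $\Gamma^\natural=\{\varphi^\natural:\varphi\in\Gamma\}$. *)

theory Defs
  imports Main "HOL-Library.Countable" "HOL-Library.FSet" "HOL-Library.Infinite_Typeclass"
begin

section \<open>Modal formulas and the logics\<close>

datatype 'v fm =
    Var 'v
  | Bot
  | And "'v fm" "'v fm"
  | Or "'v fm" "'v fm"
  | Imp "'v fm" "'v fm"
  | Box "'v fm"

abbreviation Neg :: "'v fm \<Rightarrow> 'v fm" where
  "Neg \<phi> \<equiv> Imp \<phi> Bot"

text \<open>For tautologies in the modal language, variables and boxed formulas are both treated as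
  atoms: \<open>v\<close> is consulted only at formulas of the form \<open>Var p\<close> or \<open>Box \<phi>\<close>.\<close>

primrec eval :: "('v fm \<Rightarrow> bool) \<Rightarrow> 'v fm \<Rightarrow> bool" where
  "eval v (Var p) \<longleftrightarrow> v (Var p)"
| "eval v Bot \<longleftrightarrow> False"
| "eval v (And \<phi> \<psi>) \<longleftrightarrow> eval v \<phi> \<and> eval v \<psi>"
| "eval v (Or \<phi> \<psi>) \<longleftrightarrow> eval v \<phi> \<or> eval v \<psi>"
| "eval v (Imp \<phi> \<psi>) \<longleftrightarrow> (eval v \<phi> \<longrightarrow> eval v \<psi>)"
| "eval v (Box \<phi>) \<longleftrightarrow> v (Box \<phi>)"

definition tautology :: "'v fm \<Rightarrow> bool" where
  "tautology \<phi> \<longleftrightarrow> (\<forall>v. eval v \<phi>)"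

text \<open>The three families of logics; the indices \<open>m\<close> and \<open>n\<close> are separate arguments below.\<close>

datatype logic_kind = NA | NplusA | NRA

inductive provable :: "logic_kind \<Rightarrow> nat \<Rightarrow> nat \<Rightarrow> 'v fm \<Rightarrow> bool" for M m n where
  taut: "tautology \<phi> \<Longrightarrow> provable M m n \<phi>"
| mp: "provable M m n (Imp \<phi> \<psi>) \<Longrightarrow> provable M m n \<phi> \<Longrightarrow> provable M m n \<psi>"
| nec: "provable M m n \<phi> \<Longrightarrow> provable M m n (Box \<phi>)"
| acc: "provable M m n (Imp ((Box ^^ n) \<phi>) ((Box ^^ m) \<phi>))"
| rosbox: "M = NplusA \<Longrightarrow> provable M m n (Neg (Box \<phi>)) \<Longrightarrow> provable M m n (Neg (Box (Box \<phi>)))"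
| ros: "M = NRA \<Longrightarrow> provable M m n (Neg \<phi>) \<Longrightarrow> provable M m n (Neg (Box \<phi>))"


section \<open>The modal sequent calculi\<close>

text \<open>\<open>G M m n\<close> is the calculus associated with the logic \<open>M\<close>: GNA, GN+A or GNRA.\<close>

inductive G :: "logic_kind \<Rightarrow> nat \<Rightarrow> nat \<Rightarrow> 'v fm fset \<Rightarrow> 'v fm fset \<Rightarrow> bool" for M m n where
  init: "G M m n {|\<phi>|} {|\<phi>|}"
| botL: "G M m n {|Bot|} {||}"
| andL1: "G M m n (finsert \<phi>\<^sub>1 \<Gamma>) \<Delta> \<Longrightarrow> G M m n (finsert (And \<phi>\<^sub>1 \<phi>\<^sub>2) \<Gamma>) \<Delta>"
| andL2: "G M m n (finsert \<phi>\<^sub>2 \<Gamma>) \<Delta> \<Longrightarrow> G M m n (finsert (And \<phi>\<^sub>1 \<phi>\<^sub>2) \<Gamma>) \<Delta>"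
| andR: "G M m n \<Gamma> (finsert \<phi>\<^sub>1 \<Delta>) \<Longrightarrow> G M m n \<Gamma> (finsert \<phi>\<^sub>2 \<Delta>) \<Longrightarrow>
    G M m n \<Gamma> (finsert (And \<phi>\<^sub>1 \<phi>\<^sub>2) \<Delta>)"
| orL: "G M m n (finsert \<phi>\<^sub>1 \<Gamma>) \<Delta> \<Longrightarrow> G M m n (finsert \<phi>\<^sub>2 \<Gamma>) \<Delta> \<Longrightarrow>
    G M m n (finsert (Or \<phi>\<^sub>1 \<phi>\<^sub>2) \<Gamma>) \<Delta>"
| orR1: "G M m n \<Gamma> (finsert \<phi>\<^sub>1 \<Delta>) \<Longrightarrow> G M m n \<Gamma> (finsert (Or \<phi>\<^sub>1 \<phi>\<^sub>2) \<Delta>)"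
| orR2: "G M m n \<Gamma> (finsert \<phi>\<^sub>2 \<Delta>) \<Longrightarrow> G M m n \<Gamma> (finsert (Or \<phi>\<^sub>1 \<phi>\<^sub>2) \<Delta>)"
| impL: "G M m n \<Gamma>\<^sub>1 (finsert \<phi> \<Delta>\<^sub>1) \<Longrightarrow> G M m n (finsert \<psi> \<Gamma>\<^sub>2) \<Delta>\<^sub>2 \<Longrightarrow>
    G M m n (finsert (Imp \<phi> \<psi>) (\<Gamma>\<^sub>1 |\<union>| \<Gamma>\<^sub>2)) (\<Delta>\<^sub>1 |\<union>| \<Delta>\<^sub>2)"
| impR: "G M m n (finsert \<phi> \<Gamma>) (finsert \<psi> \<Delta>) \<Longrightarrow> G M m n \<Gamma> (finsert (Imp \<phi> \<psi>) \<Delta>)"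
| wL: "G M m n \<Gamma> \<Delta> \<Longrightarrow> G M m n (finsert \<phi> \<Gamma>) \<Delta>"
| wR: "G M m n \<Gamma> \<Delta> \<Longrightarrow> G M m n \<Gamma> (finsert \<phi> \<Delta>)"
| cut: "G M m n \<Gamma>\<^sub>1 (finsert \<phi> \<Delta>\<^sub>1) \<Longrightarrow> G M m n (finsert \<phi> \<Gamma>\<^sub>2) \<Delta>\<^sub>2 \<Longrightarrow>
    G M m n (\<Gamma>\<^sub>1 |\<union>| \<Gamma>\<^sub>2) (\<Delta>\<^sub>1 |\<union>| \<Delta>\<^sub>2)"
| nec: "G M m n {||} {|\<phi>|} \<Longrightarrow> G M m n {||} {|Box \<phi>|}"
| accL: "n > m \<Longrightarrow> G M m n (finsert ((Box ^^ m) \<phi>) (finsert ((Box ^^ n) \<phi>) \<Gamma>)) \<Delta> \<Longrightarrow>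
    G M m n (finsert ((Box ^^ n) \<phi>) \<Gamma>) \<Delta>"
| accR: "m > n \<Longrightarrow> G M m n \<Gamma> (finsert ((Box ^^ m) \<phi>) (finsert ((Box ^^ n) \<phi>) \<Delta>)) \<Longrightarrow>
    G M m n \<Gamma> (finsert ((Box ^^ m) \<phi>) \<Delta>)"
| rosbox: "M = NplusA \<Longrightarrow> m = 0 \<Longrightarrow> n \<ge> 2 \<Longrightarrow> G M m n {|Box \<phi>|} {||} \<Longrightarrow>
    G M m n {|Box (Box \<phi>)|} {||}"
| ros: "M = NRA \<Longrightarrow> G M m n {|\<phi>|} {||} \<Longrightarrow> G M m n {|Box \<phi>|} {||}"


section \<open>The extended propositional language and LK\<close>

text \<open>\<open>Fresh \<phi>\<close> is the new variable \<open>p\<^sub>\<phi>\<close>.\<close>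

datatype 'v evar = Orig 'v | Fresh "'v fm"

datatype 'v pfm =
    PVar "'v evar"
  | PBot
  | PAnd "'v pfm" "'v pfm"
  | POr "'v pfm" "'v pfm"
  | PImp "'v pfm" "'v pfm"

abbreviation PTop :: "'v pfm" where
  "PTop \<equiv> PImp PBot PBot"

inductive LK :: "'v pfm fset \<Rightarrow> 'v pfm fset \<Rightarrow> bool" where
  init: "LK {|\<phi>|} {|\<phi>|}"
| botL: "LK {|PBot|} {||}"
| andL1: "LK (finsert \<phi>\<^sub>1 \<Gamma>) \<Delta> \<Longrightarrow> LK (finsert (PAnd \<phi>\<^sub>1 \<phi>\<^sub>2) \<Gamma>) \<Delta>"
| andL2: "LK (finsert \<phi>\<^sub>2 \<Gamma>) \<Delta> \<Longrightarrow> LK (finsert (PAnd \<phi>\<^sub>1 \<phi>\<^sub>2) \<Gamma>) \<Delta>"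
| andR: "LK \<Gamma> (finsert \<phi>\<^sub>1 \<Delta>) \<Longrightarrow> LK \<Gamma> (finsert \<phi>\<^sub>2 \<Delta>) \<Longrightarrow> LK \<Gamma> (finsert (PAnd \<phi>\<^sub>1 \<phi>\<^sub>2) \<Delta>)"
| orL: "LK (finsert \<phi>\<^sub>1 \<Gamma>) \<Delta> \<Longrightarrow> LK (finsert \<phi>\<^sub>2 \<Gamma>) \<Delta> \<Longrightarrow> LK (finsert (POr \<phi>\<^sub>1 \<phi>\<^sub>2) \<Gamma>) \<Delta>"
| orR1: "LK \<Gamma> (finsert \<phi>\<^sub>1 \<Delta>) \<Longrightarrow> LK \<Gamma> (finsert (POr \<phi>\<^sub>1 \<phi>\<^sub>2) \<Delta>)"
| orR2: "LK \<Gamma> (finsert \<phi>\<^sub>2 \<Delta>) \<Longrightarrow> LK \<Gamma> (finsert (POr \<phi>\<^sub>1 \<phi>\<^sub>2) \<Delta>)"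
| impL: "LK \<Gamma>\<^sub>1 (finsert \<phi> \<Delta>\<^sub>1) \<Longrightarrow> LK (finsert \<psi> \<Gamma>\<^sub>2) \<Delta>\<^sub>2 \<Longrightarrow>
    LK (finsert (PImp \<phi> \<psi>) (\<Gamma>\<^sub>1 |\<union>| \<Gamma>\<^sub>2)) (\<Delta>\<^sub>1 |\<union>| \<Delta>\<^sub>2)"
| impR: "LK (finsert \<phi> \<Gamma>) (finsert \<psi> \<Delta>) \<Longrightarrow> LK \<Gamma> (finsert (PImp \<phi> \<psi>) \<Delta>)"
| wL: "LK \<Gamma> \<Delta> \<Longrightarrow> LK (finsert \<phi> \<Gamma>) \<Delta>"
| wR: "LK \<Gamma> \<Delta> \<Longrightarrow> LK \<Gamma> (finsert \<phi> \<Delta>)"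
| cut: "LK \<Gamma>\<^sub>1 (finsert \<phi> \<Delta>\<^sub>1) \<Longrightarrow> LK (finsert \<phi> \<Gamma>\<^sub>2) \<Delta>\<^sub>2 \<Longrightarrow> LK (\<Gamma>\<^sub>1 |\<union>| \<Gamma>\<^sub>2) (\<Delta>\<^sub>1 |\<union>| \<Delta>\<^sub>2)"


section \<open>The translations\<close>

text \<open>Every formula is uniquely \<open>(Box ^^ k) \<psi>\<close> with \<open>\<psi>\<close> not boxed: \<open>k\<close> is its \<open>boxes\<close>
  and \<open>\<psi>\<close> its \<open>core\<close>.\<close>

fun boxes :: "'v fm \<Rightarrow> nat" where
  "boxes (Box \<phi>) = Suc (boxes \<phi>)"
| "boxes _ = 0"

fun core :: "'v fm \<Rightarrow> 'v fm" where
  "core (Box \<phi>) = core \<phi>"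
| "core \<phi> = \<phi>"

lemma Box_boxes_core: "(Box ^^ boxes \<phi>) (core \<phi>) = \<phi>"
  by (induction \<phi>) auto

lemma boxes_core_Box_pow:
  assumes "\<nexists>\<chi>. \<psi> = Box \<chi>"
  shows "boxes ((Box ^^ k) \<psi>) = k" and "core ((Box ^^ k) \<psi>) = \<psi>"
proof -
  have "boxes \<psi> = 0 \<and> core \<psi> = \<psi>"
    using assms by (cases \<psi>) auto
  then show "boxes ((Box ^^ k) \<psi>) = k" and "core ((Box ^^ k) \<psi>) = \<psi>"
    by (induction k) auto
qed

lemma size_Box_pow: "size ((Box ^^ k) \<phi>) = k + size \<phi>"
  by (induction k) auto

lemma size_boxes_core: "size \<phi> = boxes \<phi> + size (core \<phi>)"
  by (metis Box_boxes_core size_Box_pow)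

text \<open>The condition \<open>C(k, \<psi>)\<close> under which \<open>flat\<close> sends \<open>(Box ^^ k) \<psi>\<close> to falsum.\<close>

definition C :: "logic_kind \<Rightarrow> nat \<Rightarrow> nat \<Rightarrow> nat \<Rightarrow> 'v fm \<Rightarrow> bool" where
  "C M m n k \<psi> \<longleftrightarrow>
     M = NplusA \<and> m = 0 \<and> n \<ge> 2 \<and> k \<ge> 2 \<and> provable NplusA m n (Neg ((Box ^^ (k - 1)) \<psi>)) \<or>
     M = NRA \<and> provable NRA m n (Neg ((Box ^^ (k - 1)) \<psi>))"

function sharp flat :: "logic_kind \<Rightarrow> nat \<Rightarrow> nat \<Rightarrow> 'v fm \<Rightarrow> 'v pfm" where
  "sharp M m n Bot = PBot"
| "sharp M m n (Var p) = PVar (Orig p)"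
| "sharp M m n (And \<psi>\<^sub>1 \<psi>\<^sub>2) = PAnd (sharp M m n \<psi>\<^sub>1) (sharp M m n \<psi>\<^sub>2)"
| "sharp M m n (Or \<psi>\<^sub>1 \<psi>\<^sub>2) = POr (sharp M m n \<psi>\<^sub>1) (sharp M m n \<psi>\<^sub>2)"
| "sharp M m n (Imp \<psi>\<^sub>1 \<psi>\<^sub>2) = PImp (flat M m n \<psi>\<^sub>1) (sharp M m n \<psi>\<^sub>2)"
| "sharp M m n (Box \<chi>) =
     (let k = boxes (Box \<chi>); \<psi> = core (Box \<chi>) in
      if provable M m n ((Box ^^ (k - 1)) \<psi>) then PTop
      else if k \<ge> m \<and> m > n
        then POr (PVar (Fresh ((Box ^^ k) \<psi>))) (sharp M m n ((Box ^^ (k - m + n)) \<psi>))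
      else PVar (Fresh ((Box ^^ k) \<psi>)))"
| "flat M m n Bot = PBot"
| "flat M m n (Var p) = PVar (Orig p)"
| "flat M m n (And \<psi>\<^sub>1 \<psi>\<^sub>2) = PAnd (flat M m n \<psi>\<^sub>1) (flat M m n \<psi>\<^sub>2)"
| "flat M m n (Or \<psi>\<^sub>1 \<psi>\<^sub>2) = POr (flat M m n \<psi>\<^sub>1) (flat M m n \<psi>\<^sub>2)"
| "flat M m n (Imp \<psi>\<^sub>1 \<psi>\<^sub>2) = PImp (sharp M m n \<psi>\<^sub>1) (flat M m n \<psi>\<^sub>2)"
| "flat M m n (Box \<chi>) =
     (let k = boxes (Box \<chi>); \<psi> = core (Box \<chi>) in
      if C M m n k \<psi> then PBot
      else if k \<ge> n \<and> n > m
        then PAnd (PVar (Fresh ((Box ^^ k) \<psi>))) (flat M m n ((Box ^^ (k - n + m)) \<psi>))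
      else PVar (Fresh ((Box ^^ k) \<psi>)))"
  by pat_completeness auto

termination
proof (relation "measure (\<lambda>x. case x of Inl (_, _, _, \<phi>) \<Rightarrow> size \<phi> | Inr (_, _, _, \<phi>) \<Rightarrow> size \<phi>)",
    goal_cases)
  case 1
  show ?case by (rule wf_measure)
next
  case (8 M m n \<chi> k \<psi>)
  then show ?case using size_boxes_core[of \<chi>] by (simp add: size_Box_pow) arith
next
  case (15 M m n \<chi> k \<psi>)
  then show ?case using size_boxes_core[of \<chi>] by (simp add: size_Box_pow) arith
qed simp_all

text \<open>The box clauses restated for \<open>(Box ^^ k) \<psi>\<close>.\<close>

lemma sharp_Box_pow:
  assumes "k \<ge> 1" and "\<nexists>\<chi>. \<psi> = Box \<chi>"
  shows "sharp M m n ((Box ^^ k) \<psi>) =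
     (if provable M m n ((Box ^^ (k - 1)) \<psi>) then PTop
      else if k \<ge> m \<and> m > n
        then POr (PVar (Fresh ((Box ^^ k) \<psi>))) (sharp M m n ((Box ^^ (k - m + n)) \<psi>))
      else PVar (Fresh ((Box ^^ k) \<psi>)))"
proof -
  obtain j where "k = Suc j"
    using assms(1) by (cases k) auto
  then show ?thesis
    using boxes_core_Box_pow[OF assms(2)] by (simp add: Let_def)
qed

lemma flat_Box_pow:
  assumes "k \<ge> 1" and "\<nexists>\<chi>. \<psi> = Box \<chi>"
  shows "flat M m n ((Box ^^ k) \<psi>) =
     (if C M m n k \<psi> then PBot
      else if k \<ge> n \<and> n > m
        then PAnd (PVar (Fresh ((Box ^^ k) \<psi>))) (flat M m n ((Box ^^ (k - n + m)) \<psi>))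
      else PVar (Fresh ((Box ^^ k) \<psi>)))"
proof -
  obtain j where "k = Suc j"
    using assms(1) by (cases k) auto
  then show ?thesis
    using boxes_core_Box_pow[OF assms(2)] by (simp add: Let_def)
qed

end

theory Submission
  imports Defs
begin

text \<open>Cut blocks a direct induction on derivations, since \<open>sharp\<close> does not entail \<open>flat\<close>; the
  argument is semantic instead. As \<open>LK\<close> is complete, it suffices to refute in \<open>G\<close> every
  sequent whose translation fails under some valuation. From that valuation one builds
  a truth assignment \<open>w\<close> to modal formulas, with boxed formulas as atoms, that satisfies all
  theorems of the logic and lies between \<open>flat\<close> and \<open>sharp\<close>; \<open>G\<close> is sound for the logic, so
  \<open>w\<close> refutes the sequent. The delicate point is that \<open>w\<close> satisfies the accessibility axiom: a
  box that is true only because its content is a theorem requires \<open>w\<close> to satisfy that theorem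
  already. This is resolved by stratifying theoremhood by the nesting depth of the modal rules.\<close>

section \<open>Completeness of LK\<close>

lemma LK_weaken:
  assumes "LK \<Gamma> \<Delta>" "\<Gamma> |\<subseteq>| \<Gamma>'" "\<Delta> |\<subseteq>| \<Delta>'"
  shows "LK \<Gamma>' \<Delta>'"
proof -
  have L: "LK (\<Theta> |\<union>| \<Gamma>) \<Delta>" for \<Theta>
    by (induction \<Theta>) (auto intro: assms(1) LK.wL)
  have "LK (\<Gamma>' |\<union>| \<Gamma>) (\<Theta> |\<union>| \<Delta>)" for \<Theta>
    by (induction \<Theta>) (auto intro: L LK.wR)
  from this[of \<Delta>'] show ?thesis
    using assms(2,3) by (simp add: sup_absorb1)
qed

section \<open>Two-valued semantics of LK and Kalmar's argument\<close>

primrec peval :: "('v evar \<Rightarrow> bool) \<Rightarrow> 'v pfm \<Rightarrow> bool" where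
  "peval v (PVar x) \<longleftrightarrow> v x"
| "peval v PBot \<longleftrightarrow> False"
| "peval v (PAnd a b) \<longleftrightarrow> peval v a \<and> peval v b"
| "peval v (POr a b) \<longleftrightarrow> peval v a \<or> peval v b"
| "peval v (PImp a b) \<longleftrightarrow> (peval v a \<longrightarrow> peval v b)"

primrec pvars :: "'v pfm \<Rightarrow> 'v evar fset" where
  "pvars (PVar x) = {|x|}"
| "pvars PBot = {||}"
| "pvars (PAnd a b) = pvars a |\<union>| pvars b"
| "pvars (POr a b) = pvars a |\<union>| pvars b"
| "pvars (PImp a b) = pvars a |\<union>| pvars b"

text \<open>This is Kalmar's argument: each row of a truth table is a short derivation from
  literals. Negative literals appear as atoms on the right of the sequent.\<close>

lemma LK_valuation:
  fixes v :: "'v evar \<Rightarrow> bool"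
  assumes "pvars a |\<subseteq>| A"
  defines "S \<equiv> PVar |`| ffilter v A" and "R \<equiv> PVar |`| ffilter (\<lambda>x. \<not> v x) A"
  shows "if peval v a then LK S (finsert a R) else LK (finsert a S) R"
  using assms(1)
proof (induction a)
  case (PVar x)
  show ?case
  proof (cases "v x")
    case True
    then have "LK S (finsert (PVar x) R)"
      using PVar by (intro LK_weaken[OF LK.init[of "PVar x"]]) (auto simp: S_def)
    then show ?thesis using True by simp
  next
    case False
    then have "LK (finsert (PVar x) S) R"
      using PVar by (intro LK_weaken[OF LK.init[of "PVar x"]]) (auto simp: R_def)
    then show ?thesis using False by simp
  qed
next
  case PBot
  have "LK (finsert PBot S) R"
    by (rule LK_weaken[OF LK.botL]) auto
  then show ?case by simp
next
  case (PAnd a b)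
  then show ?case by (auto intro: LK.andR LK.andL1 LK.andL2)
next
  case (POr a b)
  then show ?case by (auto intro: LK.orL LK.orR1 LK.orR2)
next
  case (PImp a b)
  consider "\<not> peval v a" | "peval v b" | "peval v a" "\<not> peval v b" by blast
  then show ?case
  proof cases
    case 1
    then have "LK (finsert a S) (finsert b R)"
      using PImp by (auto intro: LK.wR)
    then show ?thesis using 1 by (simp add: LK.impR)
  next
    case 2
    then have "LK (finsert a S) (finsert b R)"
      using PImp by (auto intro: LK.wL)
    then show ?thesis using 2 by (simp add: LK.impR)
  next
    case 3
    then have "LK (finsert (PImp a b) (S |\<union>| S)) (R |\<union>| R)"
      using PImp by (intro LK.impL) auto
    then show ?thesis using 3 by simp
  qed
qed

text \<open>Atoms disappear one at a time: the hypothesis covers both values of an atom, and a cut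
  on it joins the two cases.\<close>

lemma LK_eliminate_atoms:
  assumes "\<And>v. LK (\<Gamma> |\<union>| PVar |`| ffilter v A) (\<Delta> |\<union>| PVar |`| ffilter (\<lambda>x. \<not> v x) A)"
  shows "LK \<Gamma> \<Delta>"
  using assms
proof (induction A arbitrary: \<Gamma> \<Delta>)
  case empty
  from empty[of "\<lambda>_. True"] show ?case by (rule LK_weaken) auto
next
  case (insert x A)
  have "LK \<Gamma> (finsert (PVar x) \<Delta>)"
  proof (rule insert.IH)
    fix v
    show "LK (\<Gamma> |\<union>| PVar |`| ffilter v A)
      (finsert (PVar x) \<Delta> |\<union>| PVar |`| ffilter (\<lambda>x. \<not> v x) A)"
      \<comment> \<open>Making \<open>x\<close> false places \<open>PVar x\<close> on the right,
        where the goal has it.\<close>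
      by (rule LK_weaken[OF insert.prems[of "v(x := False)"]]) (auto split: if_splits)
  qed
  moreover have "LK (finsert (PVar x) \<Gamma>) \<Delta>"
  proof (rule insert.IH)
    fix v
    show "LK (finsert (PVar x) \<Gamma> |\<union>| PVar |`| ffilter v A)
      (\<Delta> |\<union>| PVar |`| ffilter (\<lambda>x. \<not> v x) A)"
      by (rule LK_weaken[OF insert.prems[of "v(x := True)"]]) (auto split: if_splits)
  qed
  ultimately have "LK (\<Gamma> |\<union>| \<Gamma>) (\<Delta> |\<union>| \<Delta>)"
    by (rule LK.cut)
  then show ?case by simp
qed

text \<open>Over all variables of the sequent, each valuation makes some formula on the left false
  or some formula on the right true. That single formula already gives the derivation required by
  \<open>LK_eliminate_atoms\<close>.\<close>

lemma LK_complete: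
  assumes "\<And>v. (\<And>a. a |\<in>| \<Gamma> \<Longrightarrow> peval v a) \<Longrightarrow> \<exists>b. b |\<in>| \<Delta> \<and> peval v b"
  shows "LK \<Gamma> \<Delta>"
proof (rule LK_eliminate_atoms)
  let ?A = "ffUnion (pvars |`| (\<Gamma> |\<union>| \<Delta>))"
  fix v
  let ?S = "PVar |`| ffilter v ?A" and ?R = "PVar |`| ffilter (\<lambda>x. \<not> v x) ?A"
  have sub: "pvars a |\<subseteq>| ?A" if "a |\<in>| \<Gamma> |\<union>| \<Delta>" for a
    using that by (force simp: less_eq_fset.rep_eq ffUnion.rep_eq)
  consider a where "a |\<in>| \<Gamma>" "\<not> peval v a" | b where "b |\<in>| \<Delta>" "peval v b"
    using assms by blast
  then show "LK (\<Gamma> |\<union>| ?S) (\<Delta> |\<union>| ?R)"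
  proof cases
    case 1
    then have "LK (finsert a ?S) ?R"
      using LK_valuation[OF sub[of a], of v] by simp
    then show ?thesis using 1 by (elim LK_weaken) auto
  next
    case 2
    then have "LK ?S (finsert b ?R)"
      using LK_valuation[OF sub[of b], of v] by simp
    then show ?thesis using 2 by (elim LK_weaken) auto
  qed
qed


section \<open>Soundness of the modal calculi\<close>

lemma eval_Box_funpow: "k \<ge> 1 \<Longrightarrow> eval w ((Box ^^ k) \<phi>) = w ((Box ^^ k) \<phi>)"
  by (cases k) auto

text \<open>The members of \<open>L\<close> move one by one into antecedents of implications, which
  \<open>mp\<close> later detaches; with \<open>L\<close> empty a tautology remains.\<close>

lemma provable_consequence:
  assumes "\<And>\<theta>. \<theta> \<in> set L \<Longrightarrow> provable M m n \<theta>"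
    and "\<And>w. (\<And>\<theta>. \<theta> \<in> set L \<Longrightarrow> eval w \<theta>) \<Longrightarrow> eval w \<phi>"
  shows "provable M m n \<phi>"
  using assms
proof (induction L arbitrary: \<phi>)
  case Nil
  then show ?case by (simp add: provable.taut tautology_def)
next
  case (Cons \<theta> L)
  have "provable M m n (Imp \<theta> \<phi>)"
    by (rule Cons.IH) (use Cons.prems in auto)
  then show ?case
    by (rule provable.mp) (simp add: Cons.prems)
qed

definition sat :: "('v fm \<Rightarrow> bool) \<Rightarrow> 'v fm fset \<Rightarrow> 'v fm fset \<Rightarrow> bool" where
  "sat w \<Gamma> \<Delta> \<longleftrightarrow> ((\<forall>\<phi>|\<in>|\<Gamma>. eval w \<phi>) \<longrightarrow> (\<exists>\<phi>|\<in>|\<Delta>. eval w \<phi>))"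

text \<open>Recording the theorems used as a finite list avoids reading sequents as formulas: for
  the propositional rules the lists of the premises are kept or appended, and each valuation is
  checked separately. Only nec, rosbox and ros must turn a sequent back into a theorem, which
  \<open>provable_consequence\<close> does.\<close>

lemma G_sound:
  assumes "G M m n \<Gamma> \<Delta>"
  shows "\<exists>L. (\<forall>\<theta>\<in>set L. provable M m n \<theta>) \<and>
    (\<forall>w. (\<forall>\<theta>\<in>set L. eval w \<theta>) \<longrightarrow> sat w \<Gamma> \<Delta>)" (is "?P \<Gamma> \<Delta>")
proof -
  have one: "?P \<Gamma>' \<Delta>'" if "?P \<Gamma> \<Delta>" "\<And>w. sat w \<Gamma> \<Delta> \<Longrightarrow> sat w \<Gamma>' \<Delta>'" for \<Gamma> \<Delta> \<Gamma>' \<Delta>'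
    using that by meson
  have two: "?P \<Gamma>' \<Delta>'" if 1: "?P \<Gamma>\<^sub>1 \<Delta>\<^sub>1" and 2: "?P \<Gamma>\<^sub>2 \<Delta>\<^sub>2"
    and sat: "\<And>w. sat w \<Gamma>\<^sub>1 \<Delta>\<^sub>1 \<Longrightarrow> sat w \<Gamma>\<^sub>2 \<Delta>\<^sub>2 \<Longrightarrow> sat w \<Gamma>' \<Delta>'" for \<Gamma>\<^sub>1 \<Delta>\<^sub>1 \<Gamma>\<^sub>2 \<Delta>\<^sub>2 \<Gamma>' \<Delta>'
  proof -
    obtain L\<^sub>1 where 1: "\<forall>\<theta>\<in>set L\<^sub>1. provable M m n \<theta>"
      "\<forall>w. (\<forall>\<theta>\<in>set L\<^sub>1. eval w \<theta>) \<longrightarrow> sat w \<Gamma>\<^sub>1 \<Delta>\<^sub>1"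
      using 1 by blast
    obtain L\<^sub>2 where 2: "\<forall>\<theta>\<in>set L\<^sub>2. provable M m n \<theta>"
      "\<forall>w. (\<forall>\<theta>\<in>set L\<^sub>2. eval w \<theta>) \<longrightarrow> sat w \<Gamma>\<^sub>2 \<Delta>\<^sub>2"
      using 2 by blast
    show ?thesis
      using 1 2 sat by (intro exI[of _ "L\<^sub>1 @ L\<^sub>2"]) (auto simp: ball_Un)
  qed
  have of_theorem: "?P \<Gamma> \<Delta>" if "provable M m n \<theta>" "\<And>w. eval w \<theta> \<Longrightarrow> sat w \<Gamma> \<Delta>" for \<theta> \<Gamma> \<Delta>
    using that by (intro exI[of _ "[\<theta>]"]) simp
  \<comment> \<open>The rules accL and accR act as cuts against this sequent.\<close>
  have acc: "?P {|(Box ^^ n) \<phi>|} {|(Box ^^ m) \<phi>|}" for \<phi>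
    by (rule of_theorem[OF provable.acc[of M m n \<phi>]]) (simp add: sat_def)
  have refutable: "provable M m n (Neg \<phi>)" if "?P {|\<phi>|} {||}" for \<phi>
    using that by (auto intro: provable_consequence simp: sat_def)
  show ?thesis
    using assms
  proof (induction rule: G.induct)
    case (init \<phi>)
    show ?case by (intro exI[of _ "[]"]) (simp add: sat_def)
  next
    case botL
    show ?case by (intro exI[of _ "[]"]) (simp add: sat_def)
  next
    case (andL1 \<phi>\<^sub>1 \<Gamma> \<Delta> \<phi>\<^sub>2)
    from andL1.IH show ?case by (rule one) (auto simp: sat_def)
  next
    case (andL2 \<phi>\<^sub>2 \<Gamma> \<Delta> \<phi>\<^sub>1)
    from andL2.IH show ?case by (rule one) (auto simp: sat_def)
  next
    case (andR \<Gamma> \<phi>\<^sub>1 \<Delta> \<phi>\<^sub>2)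
    from andR.IH show ?case by (rule two) (auto simp: sat_def)
  next
    case (orL \<phi>\<^sub>1 \<Gamma> \<Delta> \<phi>\<^sub>2)
    from orL.IH show ?case by (rule two) (auto simp: sat_def)
  next
    case (orR1 \<Gamma> \<phi>\<^sub>1 \<Delta> \<phi>\<^sub>2)
    from orR1.IH show ?case by (rule one) (auto simp: sat_def)
  next
    case (orR2 \<Gamma> \<phi>\<^sub>2 \<Delta> \<phi>\<^sub>1)
    from orR2.IH show ?case by (rule one) (auto simp: sat_def)
  next
    case (impL \<Gamma>\<^sub>1 \<phi> \<Delta>\<^sub>1 \<psi> \<Gamma>\<^sub>2 \<Delta>\<^sub>2)
    from impL.IH show ?case by (rule two) (auto simp: sat_def)
  next
    case (impR \<phi> \<Gamma> \<psi> \<Delta>)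
    from impR.IH show ?case by (rule one) (auto simp: sat_def)
  next
    case (wL \<Gamma> \<Delta> \<phi>)
    from wL.IH show ?case by (rule one) (auto simp: sat_def)
  next
    case (wR \<Gamma> \<Delta> \<phi>)
    from wR.IH show ?case by (rule one) (auto simp: sat_def)
  next
    case (cut \<Gamma>\<^sub>1 \<phi> \<Delta>\<^sub>1 \<Gamma>\<^sub>2 \<Delta>\<^sub>2)
    from cut.IH show ?case by (rule two) (auto simp: sat_def)
  next
    case (nec \<phi>)
    then have "provable M m n \<phi>"
      by (auto intro: provable_consequence simp: sat_def)
    then show ?case by (intro of_theorem[OF provable.nec]) (auto simp: sat_def)
  next
    case (accL \<phi> \<Gamma> \<Delta>)
    from acc accL.IH show ?case by (rule two) (auto simp: sat_def)
  next
    case (accR \<Gamma> \<phi> \<Delta>)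
    from acc accR.IH show ?case by (rule two) (auto simp: sat_def)
  next
    case (rosbox \<phi>)
    from rosbox(1) refutable[OF rosbox.IH] have "provable M m n (Neg (Box (Box \<phi>)))"
      by (rule provable.rosbox)
    then show ?case by (rule of_theorem) (simp add: sat_def)
  next
    case (ros \<phi>)
    from ros(1) refutable[OF ros.IH] have "provable M m n (Neg (Box \<phi>))"
      by (rule provable.ros)
    then show ?case by (rule of_theorem) (simp add: sat_def)
  qed
qed


section \<open>Stratified provability\<close>

lemma boxes_funpow [simp]: "boxes ((Box ^^ k) \<phi>) = k + boxes \<phi>"
  by (induction k) auto

lemma core_funpow [simp]: "core ((Box ^^ k) \<phi>) = core \<phi>"
  by (induction k) auto

lemma funpow_Box_add: "(Box ^^ (j + k)) \<phi> = (Box ^^ j) ((Box ^^ k) \<phi>)"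
  by (simp add: funpow_add)

lemma funpow_boxes_replace: "(Box ^^ (a + boxes \<phi> - a + b)) (core \<phi>) = (Box ^^ b) \<phi>"
  using funpow_Box_add[of b "boxes \<phi>" "core \<phi>"] by (simp add: Box_boxes_core add.commute)

lemma funpow_Box_unbox:
  assumes "a \<le> boxes \<phi>"
  obtains \<theta> where "\<phi> = (Box ^^ a) \<theta>"
  using that[of "(Box ^^ (boxes \<phi> - a)) (core \<phi>)"] assms
  by (simp flip: funpow_Box_add add: Box_boxes_core)

lemma boxes_pos_iff: "0 < boxes \<phi> \<longleftrightarrow> (\<exists>\<theta>. \<phi> = Box \<theta>)"
  by (cases \<phi>) auto

context
  fixes M :: logic_kind and m n :: nat
begin

text \<open>The closure of \<open>T\<close> under propositional reasoning and one application of the modal rules to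
  members of \<open>T\<close>; rosbox is restricted as in \<open>G\<close>, which loses no theorems.\<close>

inductive step :: "('v fm \<Rightarrow> bool) \<Rightarrow> 'v fm \<Rightarrow> bool" for T where
  taut: "tautology \<phi> \<Longrightarrow> step T \<phi>"
| mp: "step T (Imp \<phi> \<psi>) \<Longrightarrow> step T \<phi> \<Longrightarrow> step T \<psi>"
| acc: "step T (Imp ((Box ^^ n) \<phi>) ((Box ^^ m) \<phi>))"
| nec: "T \<phi> \<Longrightarrow> step T (Box \<phi>)"
| rosbox: "M = NplusA \<Longrightarrow> m = 0 \<Longrightarrow> n \<ge> 2 \<Longrightarrow> T (Neg (Box \<phi>)) \<Longrightarrow> step T (Neg (Box (Box \<phi>)))"
| ros: "M = NRA \<Longrightarrow> T (Neg \<phi>) \<Longrightarrow> step T (Neg (Box \<phi>))"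

lemma step_mono:
  assumes "T \<le> T'"
  shows "step T \<le> step T'"
proof (rule predicate1I)
  fix \<phi>
  assume "step T \<phi>"
  then show "step T' \<phi>"
  proof induction
    case (rosbox \<phi>)
    then show ?case using assms by (intro step.rosbox) auto
  next
    case (ros \<phi>)
    then show ?case using assms by (intro step.ros) auto
  qed (use assms in \<open>auto intro: step.intros\<close>)
qed

text \<open>As \<open>stage 0\<close> is empty, \<open>stage (Suc h)\<close> contains what is
  derivable with modal rules nested at most \<open>h\<close> deep; propositional reasoning and the
  accessibility axiom do not count.\<close>

definition stage :: "nat \<Rightarrow> 'v fm \<Rightarrow> bool" where
  "stage h = (step ^^ h) (\<lambda>_. False)"

lemma stage_0 [simp]: "stage 0 = (\<lambda>_. False)"
  and stage_Suc: "stage (Suc h) = step (stage h)"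
  by (simp_all add: stage_def)

lemma stage_mono: "h \<le> h' \<Longrightarrow> stage h \<le> stage h'"
proof (induction h' arbitrary: h)
  case (Suc h')
  show ?case
  proof (cases h)
    case (Suc j)
    then show ?thesis
      using Suc.IH[of j] Suc.prems by (simp add: stage_Suc step_mono)
  qed (simp add: le_fun_def)
qed simp

text \<open>The condition \<open>C(k, \<psi>)\<close> for \<open>Box \<chi> = (Box ^^ k) \<psi>\<close>, with \<open>T\<close> in place of provability.\<close>

definition blocked :: "('v fm \<Rightarrow> bool) \<Rightarrow> 'v fm \<Rightarrow> bool" where
  "blocked T \<chi> \<longleftrightarrow>
     (M = NplusA \<and> m = 0 \<and> n \<ge> 2 \<and> (\<exists>\<theta>. \<chi> = Box \<theta>) \<or> M = NRA) \<and> T (Neg \<chi>)"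

text \<open>The three clauses take care of the conclusions of nec, of ros and rosbox, and of the
  accessibility axiom. Truth of the members of \<open>T\<close> themselves is not demanded.\<close>

definition model :: "('v fm \<Rightarrow> bool) \<Rightarrow> ('v fm \<Rightarrow> bool) \<Rightarrow> bool" where
  "model T w \<longleftrightarrow> (\<forall>\<chi>. T \<chi> \<longrightarrow> w (Box \<chi>)) \<and> (\<forall>\<chi>. blocked T \<chi> \<longrightarrow> \<not> w (Box \<chi>)) \<and>
     (\<forall>\<phi>. eval w ((Box ^^ n) \<phi>) \<longrightarrow> eval w ((Box ^^ m) \<phi>))"

lemma model_step:
  assumes "step T \<phi>" "model T w"
  shows "eval w \<phi>"
  using assms(1)
proof induction
  case (rosbox \<phi>)
  then have "blocked T (Box \<phi>)" unfolding blocked_def by simp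
  then show ?case using assms(2) by (simp add: model_def)
next
  case (ros \<phi>)
  then have "blocked T \<phi>" unfolding blocked_def by simp
  then show ?case using assms(2) by (simp add: model_def)
qed (use assms(2) in \<open>auto simp: model_def tautology_def\<close>)

section \<open>The stages exhaust provability\<close>

lemma stage_provable: "stage h \<phi> \<Longrightarrow> provable M m n \<phi>"
proof (induction h arbitrary: \<phi>)
  case (Suc h)
  have "step (stage h) \<phi>"
    using Suc.prems by (simp add: stage_Suc)
  then show ?case
  proof induction
    case (rosbox \<phi>)
    then show ?case by (intro provable.rosbox Suc.IH)
  next
    case (ros \<phi>)
    then show ?case by (intro provable.ros Suc.IH)
  qed (auto intro: provable.intros Suc.IH)
qed simp

lemma stage_SucI: "stage h \<phi> \<Longrightarrow> stage (Suc h) \<phi>"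
  using stage_mono[of h "Suc h"] by auto

lemma stage_mp: "stage h (Imp \<phi> \<psi>) \<Longrightarrow> stage h \<phi> \<Longrightarrow> stage h \<psi>"
  by (cases h) (auto simp: stage_Suc intro: step.mp)

text \<open>Two rules need care: \<open>mp\<close> raises both premises to a common stage, and
  rosbox is subject in \<open>step\<close> to a condition on \<open>m\<close> and \<open>n\<close>
  that \<open>provable\<close> does not impose.\<close>

lemma provable_stage:
  assumes "provable M m n \<phi>"
  obtains h where "stage h \<phi>"
proof -
  have "\<exists>h. stage h \<phi>"
    using assms
  proof induction
    case (taut \<phi>)
    then show ?case by (metis stage_Suc step.taut)
  next
    case (mp \<phi> \<psi>)
    then obtain h h' where "stage h (Imp \<phi> \<psi>)" "stage h' \<phi>" by blast
    then have "stage (max h h') (Imp \<phi> \<psi>)" "stage (max h h') \<phi>"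
      using stage_mono[of h "max h h'"] stage_mono[of h' "max h h'"] by auto
    then show ?case by (blast intro: stage_mp)
  next
    case (nec \<phi>)
    then show ?case by (metis stage_Suc step.nec)
  next
    case (acc \<phi>)
    then show ?case by (metis stage_Suc step.acc)
  next
    case (rosbox \<phi>)
    then obtain h where h: "stage h (Neg (Box \<phi>))" by blast
    consider "m = 0" "n \<ge> 2" | "m = 0" "n = 1" | "m \<ge> 1 \<or> n = 0" by linarith
    then show ?case
    proof cases
      case 1
      then show ?thesis using h rosbox(1) by (metis stage_Suc step.rosbox)
    next
      case 2
      have h': "stage (Suc h) (Neg (Box \<phi>))"
        using h by (rule stage_SucI)
      \<comment> \<open>For \<open>m = 0\<close> and \<open>n = 1\<close> the rule is contraposition
        of the accessibility axiom at \<open>Box \<phi>\<close>.\<close>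
      have "stage (Suc h) (Imp (Box (Box \<phi>)) (Box \<phi>))"
        unfolding stage_Suc using step.acc[of "stage h" "Box \<phi>"] 2 by simp
      moreover have "stage (Suc h)
          (Imp (Imp (Box (Box \<phi>)) (Box \<phi>)) (Imp (Neg (Box \<phi>)) (Neg (Box (Box \<phi>)))))"
        unfolding stage_Suc by (rule step.taut) (auto simp: tautology_def)
      ultimately show ?thesis using h' by (blast intro: stage_mp)
    next
      case 3
      \<comment> \<open>Nothing is blocked here, so making every box true gives a model. Hence no
        negated box is a theorem and the premise of the rule is impossible.\<close>
      have "model (stage h) (\<lambda>_. True)"
        unfolding model_def blocked_def using 3 rosbox(1)
        by (cases "m = 0") (auto simp: eval_Box_funpow)
      then show ?thesis
        using model_step[of "stage h" "Neg (Box \<phi>)" "\<lambda>_. True"] stage_SucI[OF h]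
        by (auto simp: stage_Suc)
    qed
  next
    case (ros \<phi>)
    then show ?case by (metis stage_Suc step.ros)
  qed
  then show ?thesis using that by blast
qed


section \<open>The truth assignment between flat and sharp\<close>

text \<open>\<open>u\<close> is consulted only at variables and boxed formulas.\<close>

function assign :: "('v fm \<Rightarrow> bool) \<Rightarrow> ('v fm \<Rightarrow> bool) \<Rightarrow> 'v fm \<Rightarrow> bool" where
  "assign T u (Var p) \<longleftrightarrow> u (Var p)"
| "assign T u Bot \<longleftrightarrow> False"
| "assign T u (And \<phi> \<psi>) \<longleftrightarrow> assign T u \<phi> \<and> assign T u \<psi>"
| "assign T u (Or \<phi> \<psi>) \<longleftrightarrow> assign T u \<phi> \<or> assign T u \<psi>"
| "assign T u (Imp \<phi> \<psi>) \<longleftrightarrow> (assign T u \<phi> \<longrightarrow> assign T u \<psi>)"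
| "assign T u (Box \<chi>) \<longleftrightarrow> T \<chi> \<or> \<not> blocked T \<chi> \<and>
     (if n > m \<and> boxes (Box \<chi>) \<ge> n
      then u (Box \<chi>) \<and> assign T u ((Box ^^ (boxes (Box \<chi>) - n + m)) (core \<chi>))
      else if m > n \<and> boxes (Box \<chi>) \<ge> m
      then u (Box \<chi>) \<or> assign T u ((Box ^^ (boxes (Box \<chi>) - m + n)) (core \<chi>))
      else u (Box \<chi>))"
  by pat_completeness auto

termination
proof (relation "measure (\<lambda>(T, u, \<phi>). size \<phi>)", goal_cases)
  case 1
  show ?case by (rule wf_measure)
next
  case (8 T u \<chi>)
  then show ?case using size_boxes_core[of \<chi>] by (simp add: size_Box_pow) arith
next
  case (9 T u \<chi>)
  then show ?case using size_boxes_core[of \<chi>] by (simp add: size_Box_pow) arith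
qed simp_all

declare assign.simps(6) [simp del]

lemma eval_assign [simp]: "eval (assign T u) \<phi> = assign T u \<phi>"
  by (induction \<phi>) simp_all

text \<open>The recursive call counts boxes down to the core, but its effect is to exchange
  \<open>n\<close> outer boxes for \<open>m\<close>, even when \<open>\<phi>\<close> is itself
  boxed.\<close>

lemma assign_Box_descend:
  assumes "n > m" "Box \<chi> = (Box ^^ n) \<phi>"
  shows "assign T u (Box \<chi>) \<longleftrightarrow>
    T \<chi> \<or> \<not> blocked T \<chi> \<and> u (Box \<chi>) \<and> assign T u ((Box ^^ m) \<phi>)"
proof -
  have "boxes (Box \<chi>) = n + boxes \<phi>" "core \<chi> = core \<phi>"
    using assms(2) boxes_funpow[of n \<phi>] core_funpow[of n \<phi>] by (metis, metis core.simps(1))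
  then show ?thesis
    using assms(1) funpow_boxes_replace[of n \<phi> m] by (simp add: assign.simps(6))
qed

lemma assign_Box_ascend:
  assumes "m > n" "Box \<chi> = (Box ^^ m) \<phi>"
  shows "assign T u (Box \<chi>) \<longleftrightarrow>
    T \<chi> \<or> \<not> blocked T \<chi> \<and> (u (Box \<chi>) \<or> assign T u ((Box ^^ n) \<phi>))"
proof -
  have "boxes (Box \<chi>) = m + boxes \<phi>" "core \<chi> = core \<phi>"
    using assms(2) boxes_funpow[of m \<phi>] core_funpow[of m \<phi>] by (metis, metis core.simps(1))
  then show ?thesis
    using assms(1) funpow_boxes_replace[of m \<phi> n] by (simp add: assign.simps(6))
qed

lemma assign_Box_cases:
  obtains (descend) \<phi> where "n > m" "Box \<chi> = (Box ^^ n) \<phi>"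
  | (ascend) \<phi> where "m > n" "Box \<chi> = (Box ^^ m) \<phi>"
  | (free) "\<And>T u. assign T u (Box \<chi>) \<longleftrightarrow> T \<chi> \<or> \<not> blocked T \<chi> \<and> u (Box \<chi>)"
proof -
  consider "n > m" "boxes (Box \<chi>) \<ge> n" | "m > n" "boxes (Box \<chi>) \<ge> m"
    | "\<not> (n > m \<and> boxes (Box \<chi>) \<ge> n)" "\<not> (m > n \<and> boxes (Box \<chi>) \<ge> m)" by blast
  then show ?thesis
  proof cases
    case 1
    then show ?thesis using funpow_Box_unbox[of n "Box \<chi>"] descend by metis
  next
    case 2
    then show ?thesis using funpow_Box_unbox[of m "Box \<chi>"] ascend by metis
  next
    case 3
    then have "assign T u (Box \<chi>) \<longleftrightarrow> T \<chi> \<or> \<not> blocked T \<chi> \<and> u (Box \<chi>)" for T u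
      by (simp only: assign.simps(6) if_False)
    then show ?thesis using free by metis
  qed
qed

lemma assign_member: "T \<chi> \<Longrightarrow> assign T u (Box \<chi>)"
  by (simp add: assign.simps(6))

lemma assign_blocked: "blocked T \<chi> \<Longrightarrow> \<not> T \<chi> \<Longrightarrow> \<not> assign T u (Box \<chi>)"
  by (simp add: assign.simps(6))

text \<open>For \<open>n \<ge> m\<close> every way of making a box true other than membership in
  \<open>T\<close> needs \<open>u\<close>. This serves to invert nec.\<close>

lemma assign_all_false:
  assumes "n \<ge> m" "assign T (\<lambda>_. False) (Box \<chi>)"
  shows "T \<chi>"
  using assms by (simp add: assign.simps(6) split: if_splits)

text \<open>Dually, for \<open>m \<ge> n\<close> a true \<open>u\<close> can only be overruled by
  blocking. This serves to invert ros.\<close>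

lemma assign_all_true:
  assumes "m \<ge> n" "\<not> assign T (\<lambda>_. True) (Box \<chi>)"
  shows "blocked T \<chi>"
  using assms by (simp add: assign.simps(6) split: if_splits)

text \<open>Feeding an assignment for \<open>T\<close> back into the construction for a smaller \<open>T'\<close> reproduces it,
  as far as it satisfies the accessibility axiom.\<close>

lemma assign_reproduce:
  assumes "T' \<le> T" and consistent: "\<And>\<chi>. T \<chi> \<Longrightarrow> T (Neg \<chi>) \<Longrightarrow> False"
    and acc: "\<And>\<theta>. size \<theta> < s \<Longrightarrow>
      assign T u ((Box ^^ n) \<theta>) \<Longrightarrow> assign T u ((Box ^^ m) \<theta>)"
  shows "size \<phi> \<le> s \<Longrightarrow> assign T' (assign T u) \<phi> = assign T u \<phi>"
proof (induction "size \<phi>" arbitrary: \<phi> rule: less_induct)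
  case less
  let ?w = "assign T u"
  show ?case
  proof (cases \<phi>)
    case (Box \<chi>)
    have T': "T' \<chi> \<Longrightarrow> ?w (Box \<chi>)"
      using assms(1) by (auto intro: assign_member)
    \<comment> \<open>Blocking passes from \<open>T'\<close> to \<open>T\<close>; there it makes the
      box false, unless \<open>\<chi>\<close> is in \<open>T\<close> together with its
      negation.\<close>
    have unblocked: "\<not> blocked T' \<chi>" if "?w (Box \<chi>)"
      using that assms(1) consistent[of \<chi>] assign_blocked[of T \<chi> u] by (auto simp: blocked_def)
    show ?thesis
      unfolding Box
    proof (cases \<chi> rule: assign_Box_cases)
      case (descend \<theta>)
      have sz: "size \<phi> = n + size \<theta>"
        using descend(2) Box by (simp add: size_Box_pow)
      have IH: "assign T' ?w ((Box ^^ m) \<theta>) = ?w ((Box ^^ m) \<theta>)"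
        using sz descend(1) less.prems by (intro less.hyps) (simp_all add: size_Box_pow)
      \<comment> \<open>Since \<open>n\<close> is positive, \<open>\<theta>\<close> is below the
        size bound and the axiom applies to it. It makes the extra conjunct of the box clause
        redundant.\<close>
      have "?w (Box \<chi>) \<Longrightarrow> ?w ((Box ^^ m) \<theta>)"
        using acc[of \<theta>] sz descend less.prems by simp
      then show "assign T' ?w (Box \<chi>) = ?w (Box \<chi>)"
        using T' unblocked IH by (auto simp: assign_Box_descend[OF descend, of T'])
    next
      case (ascend \<theta>)
      have sz: "size \<phi> = m + size \<theta>"
        using ascend(2) Box by (simp add: size_Box_pow)
      have IH: "assign T' ?w ((Box ^^ n) \<theta>) = ?w ((Box ^^ n) \<theta>)"
        using sz ascend(1) less.prems by (intro less.hyps) (simp_all add: size_Box_pow)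
      \<comment> \<open>Dually, the axiom makes the extra disjunct redundant.\<close>
      have "?w ((Box ^^ n) \<theta>) \<Longrightarrow> ?w (Box \<chi>)"
        using acc[of \<theta>] sz ascend less.prems by simp
      then show "assign T' ?w (Box \<chi>) = ?w (Box \<chi>)"
        using T' unblocked IH by (auto simp: assign_Box_ascend[OF ascend, of T'])
    next
      case free
      show "assign T' ?w (Box \<chi>) = ?w (Box \<chi>)"
        using T' unblocked free[of T' ?w] by auto
    qed
  qed (use less in auto)
qed

section \<open>Adequacy of the stages and of provability\<close>

definition adequate :: "('v fm \<Rightarrow> bool) \<Rightarrow> bool" where
  "adequate T \<longleftrightarrow> (\<forall>u. model T (assign T u))"

text \<open>Adequacy leaves \<open>u\<close> free, so \<open>u\<close> can later be constantly
  false, constantly true, or an assignment already built.\<close>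

lemma adequate_step: "adequate T \<Longrightarrow> step T \<phi> \<Longrightarrow> assign T u \<phi>"
  using model_step[of T \<phi> "assign T u"] by (simp add: adequate_def)

text \<open>The hard clause of \<open>model\<close> is the accessibility axiom, proved by induction
  on the size of its formula. When the box clause alone does not give the axiom, nec or ros is
  undone inside \<open>T\<close>. If this reaches the bare formula, \<open>cover\<close> puts it or
  its negation into \<open>step T'\<close> for an adequate \<open>T'\<close>, and
  \<open>assign_reproduce\<close> transfers its truth to the assignment for \<open>T\<close>.
  Covering pairs of formulas yields consistency.\<close>

lemma adequate_cover:
  fixes T :: "'v fm \<Rightarrow> bool"
  assumes cover: "\<And>\<phi> \<psi>. T \<phi> \<Longrightarrow> T \<psi> \<Longrightarrow> \<exists>T' \<le> T. adequate T' \<and> step T' \<phi> \<and> step T' \<psi>"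
  shows "adequate T"
  unfolding adequate_def model_def eval_assign
proof (intro allI conjI impI)
  fix u :: "'v fm \<Rightarrow> bool" and \<phi> \<chi> :: "'v fm"
  let ?w = "assign T u"
  show "?w (Box \<chi>)" if "T \<chi>"
    using that by (rule assign_member)
  \<comment> \<open>A common \<open>T'\<close> would make one assignment satisfy both a formula and
    its negation.\<close>
  have consistent: False if "T \<theta>" "T (Neg \<theta>)" for \<theta>
    using cover[OF that] adequate_step[where \<phi> = \<theta>] adequate_step[where \<phi> = "Neg \<theta>"]
    by (metis assign.simps(2,5))
  show blocked: "\<not> ?w (Box \<chi>)" if "blocked T \<chi>" for \<chi>
    using that consistent by (intro assign_blocked) (auto simp: blocked_def)
  \<comment> \<open>With \<open>u\<close> constantly false, a box is true only if its content is in
    \<open>T'\<close>.\<close>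
  have unnec: "T \<theta>" if "m < n" "T (Box \<theta>)" for \<theta>
    using cover[OF that(2) that(2)] adequate_step[where \<phi> = "Box \<theta>"] assign_all_false that(1)
    by (metis less_imp_le predicate1D)
  \<comment> \<open>With \<open>u\<close> constantly true, a box is false only if it is blocked for
    \<open>T'\<close>.\<close>
  have unros: "T (Neg \<theta>)" if ros: "n < m" "T (Neg (Box \<theta>))" for \<theta>
  proof -
    obtain T' where T': "T' \<le> T" "adequate T'" "step T' (Neg (Box \<theta>))"
      using cover[OF ros(2) ros(2)] by blast
    then have "\<not> assign T' (\<lambda>_. True) (Box \<theta>)"
      using adequate_step[of T' "Neg (Box \<theta>)" "\<lambda>_. True"] by simp
    then have "blocked T' \<theta>"
      using ros(1) by (intro assign_all_true) auto
    then show ?thesis using T'(1) by (auto simp: blocked_def)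
  qed
  have unnecs: "T \<theta>" if "m < n" "T ((Box ^^ i) \<theta>)" for i \<theta>
    using that(2) by (induction i) (auto intro: unnec[OF that(1)])
  have unross: "T (Neg \<theta>)" if "n < m" "T (Neg ((Box ^^ i) \<theta>))" for i \<theta>
    using that(2) by (induction i) (auto intro: unros[OF that(1)])
  show "?w ((Box ^^ n) \<phi>) \<Longrightarrow> ?w ((Box ^^ m) \<phi>)"
  proof (induction "size \<phi>" arbitrary: \<phi> rule: less_induct)
    case less
    \<comment> \<open>Reproduction up to the size of \<open>\<phi>\<close> uses the axiom only at
      smaller formulas, which is the induction hypothesis.\<close>
    have reproduce: "assign T' ?w \<theta> = ?w \<theta>" if "T' \<le> T" "size \<theta> \<le> size \<phi>" for T' \<theta>
      using that(1) consistent less.hyps that(2) by (rule assign_reproduce)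
    have true: "?w \<theta>" if \<theta>: "T \<theta>" and sz: "size \<theta> \<le> size \<phi>" for \<theta>
    proof -
      obtain T' where T': "T' \<le> T" "adequate T'" "step T' \<theta>"
        using cover[OF \<theta> \<theta>] by blast
      then have "assign T' ?w \<theta>"
        using adequate_step by blast
      then show ?thesis
        using reproduce[OF T'(1) sz] by blast
    qed
    consider "n = m" | "m < n" | "n < m" by linarith
    then show ?case
    proof cases
      case 1
      then show ?thesis using less.prems by simp
    next
      case 2
      define \<chi> where "\<chi> = (Box ^^ (n - 1)) \<phi>"
      have \<chi>: "Box \<chi> = (Box ^^ n) \<phi>"
        using 2 unfolding \<chi>_def by (cases n) auto
      show ?thesis
      proof (cases "T \<chi>")
        \<comment> \<open>Membership of \<open>\<chi>\<close> makes the outer box true without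
          saying anything about \<open>(Box ^^ m) \<phi>\<close>. Undoing nec puts into
          \<open>T\<close> either \<open>\<phi>\<close> itself, for \<open>m = 0\<close>, or the
          content of the outermost of the \<open>m\<close> boxes.\<close>
        case True
        show ?thesis
        proof (cases m)
          case 0
          have "T \<phi>"
            using True unnecs[OF 2] unfolding \<chi>_def by blast
          then show ?thesis using true 0 by simp
        next
          case (Suc i)
          have "\<chi> = (Box ^^ (n - m)) ((Box ^^ i) \<phi>)"
            using 2 Suc unfolding \<chi>_def by (simp flip: funpow_Box_add)
          then have "T ((Box ^^ i) \<phi>)"
            using True unnecs[OF 2] by blast
          then have "?w (Box ((Box ^^ i) \<phi>))" by (rule assign_member)
          then show ?thesis using Suc by simp
        qed
      next
        case False
        then show ?thesis
          using assign_Box_descend[OF 2 \<chi>, of T u] less.prems \<chi> by simp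
      qed
    next
      case 3
      define \<chi> where "\<chi> = (Box ^^ (m - 1)) \<phi>"
      have \<chi>: "Box \<chi> = (Box ^^ m) \<phi>"
        using 3 unfolding \<chi>_def by (cases m) auto
      have "\<not> blocked T \<chi>"
      proof
        assume "blocked T \<chi>"
        \<comment> \<open>Here \<open>m\<close> is positive, which excludes blocking by
          rosbox.\<close>
        then have M: "M = NRA" and neg: "T (Neg \<chi>)"
          using 3 by (auto simp: blocked_def)
        show False
        proof (cases n)
          case 0
          have "T (Neg \<phi>)"
            using neg unross[OF 3] unfolding \<chi>_def by blast
          then obtain T' where T': "T' \<le> T" "adequate T'" "step T' (Neg \<phi>)"
            using cover by blast
          then have "\<not> assign T' ?w \<phi>"
            using adequate_step[of T' "Neg \<phi>"] by simp
          then have "\<not> ?w \<phi>"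
            using reproduce[OF T'(1), of \<phi>] by simp
          then show False using less.prems 0 by simp
        next
          case (Suc i)
          have "\<chi> = (Box ^^ (m - n)) ((Box ^^ i) \<phi>)"
            using 3 Suc unfolding \<chi>_def by (simp flip: funpow_Box_add)
          then have "T (Neg ((Box ^^ i) \<phi>))"
            using neg unross[OF 3] by blast
          then have "blocked T ((Box ^^ i) \<phi>)"
            unfolding blocked_def using M by simp
          then show False using blocked less.prems Suc by simp
        qed
      qed
      then show ?thesis
        using assign_Box_ascend[OF 3 \<chi>, of T u] less.prems \<chi> by simp
    qed
  qed
qed

text \<open>Each stage covers the next one, and the empty stage is covered vacuously.\<close>

lemma adequate_stage: "adequate (stage h)"
proof (induction h)
  case 0
  show ?case by (rule adequate_cover) simp
next
  case (Suc h)
  show ?case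
    by (rule adequate_cover)
      (use Suc stage_mono[of h "Suc h"] in \<open>auto simp: stage_Suc intro!: exI[of _ "stage h"]\<close>)
qed

text \<open>Provability is the union of an increasing chain of stages, so any two theorems arise by
  \<open>step\<close> from one of them. This is the covering condition for provability
  itself.\<close>

lemma provable_common_stage:
  assumes "provable M m n \<phi>" "provable M m n \<psi>"
  shows "\<exists>T' \<le> provable M m n. adequate T' \<and> step T' \<phi> \<and> step T' \<psi>"
proof -
  obtain h h' where h: "stage h \<phi>" "stage h' \<psi>"
    using assms by (metis provable_stage)
  let ?k = "max h h'"
  have "stage (Suc ?k) \<phi>" "stage (Suc ?k) \<psi>"
    using h stage_mono[of h "Suc ?k"] stage_mono[of h' "Suc ?k"]
    by (auto simp: le_SucI)
  moreover have "stage ?k \<le> provable M m n"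
    using stage_provable by blast
  ultimately show ?thesis
    using adequate_stage[of ?k] by (auto simp: stage_Suc)
qed

lemma assign_provable:
  assumes "provable M m n \<phi>"
  shows "assign (provable M m n) u \<phi>"
proof (rule adequate_step)
  show "adequate (provable M m n)"
    by (intro adequate_cover provable_common_stage)
  show "step (provable M m n) \<phi>"
    using provable_common_stage[OF assms assms] step_mono by blast
qed

section \<open>Comparison of the assignment with the translations\<close>

lemma C_iff_blocked:
  "C M m n (boxes (Box \<chi>)) (core (Box \<chi>)) \<longleftrightarrow> blocked (provable M m n) \<chi>"
proof -
  have "boxes (Box \<chi>) \<ge> 2 \<longleftrightarrow> (\<exists>\<theta>. \<chi> = Box \<theta>)"
    using boxes_pos_iff[of \<chi>] by auto
  moreover have "(Box ^^ (boxes (Box \<chi>) - 1)) (core (Box \<chi>)) = \<chi>"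
    by (simp add: Box_boxes_core)
  ultimately show ?thesis
    by (auto simp: C_def blocked_def)
qed

text \<open>Both implications are proved together because implication swaps the translations in its
  antecedent. At a box, \<open>assign\<close> shares the conjunctive recursion of
  \<open>flat\<close> when \<open>n > m\<close> and the disjunctive recursion of
  \<open>sharp\<close> when \<open>m > n\<close>; the opposite translation has just the atom or a
  constant.\<close>

lemma flat_assign_sharp:
  fixes v :: "'v evar \<Rightarrow> bool"
  defines "u \<equiv> \<lambda>\<phi>. case \<phi> of Var p \<Rightarrow> v (Orig p) | _ \<Rightarrow> v (Fresh \<phi>)"
  defines "w \<equiv> assign (provable M m n) u"
  shows "(peval v (flat M m n \<phi>) \<longrightarrow> w \<phi>) \<and> (w \<phi> \<longrightarrow> peval v (sharp M m n \<phi>))"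
proof (induction "size \<phi>" arbitrary: \<phi> rule: less_induct)
  case less
  show ?case
  proof (cases \<phi>)
    case (Box \<chi>)
    let ?k = "boxes (Box \<chi>)" and ?\<psi> = "core (Box \<chi>)"
    have flat: "flat M m n (Box \<chi>) =
     (if blocked (provable M m n) \<chi> then PBot
      else if ?k \<ge> n \<and> n > m
        then PAnd (PVar (Fresh (Box \<chi>))) (flat M m n ((Box ^^ (?k - n + m)) ?\<psi>))
      else PVar (Fresh (Box \<chi>)))"
      unfolding flat.simps Let_def C_iff_blocked Box_boxes_core ..
    have "(Box ^^ (?k - 1)) ?\<psi> = \<chi>"
      by (simp add: Box_boxes_core)
    then have sharp: "sharp M m n (Box \<chi>) =
     (if provable M m n \<chi> then PTop
      else if ?k \<ge> m \<and> m > n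
        then POr (PVar (Fresh (Box \<chi>))) (sharp M m n ((Box ^^ (?k - m + n)) ?\<psi>))
      else PVar (Fresh (Box \<chi>)))"
      unfolding sharp.simps Let_def Box_boxes_core by (rule arg_cong)
    have u: "u (Box \<chi>) = v (Fresh (Box \<chi>))"
      by (simp add: u_def)
    have sz: "size \<phi> = ?k + size ?\<psi>"
      using size_boxes_core[of \<phi>] Box by simp
    have IH_n: "(peval v (flat M m n ((Box ^^ (?k - n + m)) ?\<psi>)) \<longrightarrow> w ((Box ^^ (?k - n + m)) ?\<psi>))"
      if "?k \<ge> n" "n > m"
      by (rule less.hyps[THEN conjunct1]) (use sz that in \<open>simp add: size_Box_pow\<close>)
    have IH_m: "(w ((Box ^^ (?k - m + n)) ?\<psi>) \<longrightarrow> peval v (sharp M m n ((Box ^^ (?k - m + n)) ?\<psi>)))"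
      if "?k \<ge> m" "m > n"
      by (rule less.hyps[THEN conjunct2]) (use sz that in \<open>simp add: size_Box_pow\<close>)
    show ?thesis
      unfolding Box flat sharp
      using IH_n IH_m u by (auto simp: w_def assign.simps(6) simp del: boxes.simps)
  qed (use less in \<open>auto simp: w_def u_def\<close>)
qed

end

theorem theorem5p5:
  fixes M :: logic_kind and m n :: nat
    and \<Gamma> \<Delta> :: "'v::{countable, infinite} fm fset"
  assumes "G M m n \<Gamma> \<Delta>"
  shows "LK (flat M m n |`| \<Gamma>) (sharp M m n |`| \<Delta>)"
proof (rule LK_complete)
  fix v :: "'v evar \<Rightarrow> bool"
  assume \<Gamma>: "\<And>a. a |\<in>| flat M m n |`| \<Gamma> \<Longrightarrow> peval v a"
  define u where "u \<phi> = (case \<phi> of Var p \<Rightarrow> v (Orig p) | _ \<Rightarrow> v (Fresh \<phi>))" for \<phi>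
  define w where "w = assign M m n (provable M m n) u"
  have between: "peval v (flat M m n \<phi>) \<Longrightarrow> w \<phi>" "w \<phi> \<Longrightarrow> peval v (sharp M m n \<phi>)" for \<phi>
    using flat_assign_sharp[of v M m n \<phi>] by (auto simp: w_def u_def[abs_def])
  obtain L where L: "\<And>\<theta>. \<theta> \<in> set L \<Longrightarrow> provable M m n \<theta>"
    "\<And>w. (\<And>\<theta>. \<theta> \<in> set L \<Longrightarrow> eval w \<theta>) \<Longrightarrow> sat w \<Gamma> \<Delta>"
    using G_sound[OF assms] by blast
  \<comment> \<open>By \<open>assign_provable\<close>, \<open>w\<close> satisfies the theorems in
    \<open>L\<close>, so soundness applies to it.\<close>
  have "sat w \<Gamma> \<Delta>"
    by (rule L(2)) (simp add: w_def assign_provable L(1))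
  then show "\<exists>b. b |\<in>| sharp M m n |`| \<Delta> \<and> peval v b"
    using \<Gamma> between unfolding sat_def by (fastforce simp: w_def)
qed

end
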